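(* For every $\varepsilon>0$ there exists a family $(B_p)_{0<p<1}$ of vertex subdiagrams of the Pascal diagram such that, denoting by $X_p$ the path space of $B_p$: 1) $\nu_p(X_p)>1-\varepsilon$ for each $p\in(0,1)$; 2) the sets $X_p$, $0<p<1$, are pairwise disjoint.
   Context: The Pascal diagram is the infinite graded graph with vertex set $\mathbb Z_+\times\mathbb Z_+$ (where $\mathbb Z_+=\{0,1,2,\dots\}$), levels $V_n=\{(i,j)\in\mathbb Z_+\times\mathbb Z_+: i+j=n\}$, and, from each vertex $(i,j)$, exactly one edge to $(i+1,j)$ and exactly one edge to $(i,j+1)$. Its path space is the set of all infinite paths $(e_0,e_1,\dots)$ starting at $(0,0)$, where $e_n$ joins a vertex of $V_n$ to a vertex of $V_{n+1}$ and consecutive edges are connected; the topology is generated by cylinder sets (sets of all infinite paths with a prescribed finite initial segment). For $0<p<1$, $\nu_p$ is the Borel probability measure on the path space for which the measure of a cylinder set is the product of the weights of its edges, where each edge $(v,v+(1,0))$ has weight $p$ and each edge $(v,v+(0,1))$ has weight $1-p$. A vertex subdiagram is given by nonempty subsets $W_n\subset V_n$, $n\ge 0$, together with all edges of the Pascal diagram joining a vertex of $W_n$ to a vertex of $W_{n+1}$, such that every vertex of $W_n$ is the source of some edge of the subdiagram and every vertex of $W_{n+1}$ is the range of some edge of the subdiagram. Its path space is the set of infinite paths from $(0,0)$ all of whose edges belong to the subdiagram, viewed as a subset of the path space of the Pascal diagram. *)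

theory Defs
  imports "HOL-Probability.Probability"
begin

type_synonym vertex = "nat \<times> nat"

text \<open>Edges are identified with their (source, range) pairs; this is lossless since the Pascal
  diagram has no multiple edges.\<close>

type_synonym edge = "vertex \<times> vertex"

definition pascal_level :: "nat \<Rightarrow> vertex set" where
  "pascal_level n = {(i, j). i + j = n}"

definition pascal_edges :: "edge set" where
  "pascal_edges = range (\<lambda>v. (v, v + (1, 0))) \<union> range (\<lambda>v. (v, v + (0, 1)))"

definition pascal_paths :: "(nat \<Rightarrow> edge) set" where
  "pascal_paths =
     {x. fst (x 0) = (0, 0) \<and>
         (\<forall>n. x n \<in> pascal_edges
            \<and> fst (x n) \<in> pascal_level n \<and> snd (x n) \<in> pascal_level (Suc n)
            \<and> snd (x n) = fst (x (Suc n)))}"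

text \<open>Every finite path starting at the root extends to an infinite one, so prescribing a finite
  initial segment amounts to prescribing the first \<open>n\<close> edges of some infinite path \<open>x\<close>.\<close>

definition cylinder :: "(nat \<Rightarrow> edge) \<Rightarrow> nat \<Rightarrow> (nat \<Rightarrow> edge) set" where
  "cylinder x n = {y \<in> pascal_paths. \<forall>k<n. y k = x k}"

definition cylinders :: "(nat \<Rightarrow> edge) set set" where
  "cylinders = {cylinder x n | x n. x \<in> pascal_paths}"

definition path_topology :: "(nat \<Rightarrow> edge) topology" where
  "path_topology = topology_generated_by cylinders"

definition path_borel :: "(nat \<Rightarrow> edge) measure" where
  "path_borel = sigma (topspace path_topology) {U. openin path_topology U}"

definition edge_weight :: "real \<Rightarrow> edge \<Rightarrow> real" where
  "edge_weight p e = (if snd e = fst e + (1, 0) then p else 1 - p)"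

text \<open>Existence and uniqueness of this measure for \<open>0 < p < 1\<close> are proved below
  (\<open>ex1_is_pascal_measure\<close>), so the definite description is meaningful.\<close>

definition is_pascal_measure :: "real \<Rightarrow> (nat \<Rightarrow> edge) measure \<Rightarrow> bool" where
  "is_pascal_measure p M \<longleftrightarrow>
     sets M = sets path_borel \<and> prob_space M \<and>
     (\<forall>x\<in>pascal_paths. \<forall>n. measure M (cylinder x n) = (\<Prod>k<n. edge_weight p (x k)))"

definition pascal_measure :: "real \<Rightarrow> (nat \<Rightarrow> edge) measure" where
  "pascal_measure p = (THE M. is_pascal_measure p M)"

text \<open>A vertex subdiagram is determined by its vertex sets \<open>W n\<close>, and is represented by them.\<close>

definition subdiagram_edges :: "(nat \<Rightarrow> vertex set) \<Rightarrow> edge set" where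
  "subdiagram_edges W = (\<Union>n. {e \<in> pascal_edges. fst e \<in> W n \<and> snd e \<in> W (Suc n)})"

definition vertex_subdiagram :: "(nat \<Rightarrow> vertex set) \<Rightarrow> bool" where
  "vertex_subdiagram W \<longleftrightarrow>
     (\<forall>n. W n \<noteq> {} \<and> W n \<subseteq> pascal_level n
        \<and> (\<forall>v\<in>W n. \<exists>e\<in>subdiagram_edges W. fst e = v)
        \<and> (\<forall>v\<in>W (Suc n). \<exists>e\<in>subdiagram_edges W. snd e = v))"

definition subdiagram_paths :: "(nat \<Rightarrow> vertex set) \<Rightarrow> (nat \<Rightarrow> edge) set" where
  "subdiagram_paths W = {x \<in> pascal_paths. \<forall>n. x n \<in> subdiagram_edges W}"


primrec walk :: "(nat \<Rightarrow> bool) \<Rightarrow> nat \<Rightarrow> vertex" where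
  "walk w 0 = (0, 0)"
| "walk w (Suc n) = walk w n + (if w n then (1, 0) else (0, 1))"

definition walk_path :: "(nat \<Rightarrow> bool) \<Rightarrow> nat \<Rightarrow> edge" where
  "walk_path w n = (walk w n, walk w (Suc n))"

definition steps :: "(nat \<Rightarrow> edge) \<Rightarrow> nat \<Rightarrow> bool" where
  "steps x n \<longleftrightarrow> snd (x n) = fst (x n) + (1, 0)"

lemma walk_level: "walk w n \<in> pascal_level n"
  by (induction n) (auto simp: pascal_level_def plus_prod_def)

lemma walk_path_in_paths: "walk_path w \<in> pascal_paths"
  using walk_level[of w] walk_level[of w "Suc _"]
  by (auto simp: pascal_paths_def walk_path_def pascal_edges_def simp del: One_nat_def)

lemma steps_walk_path [simp]: "steps (walk_path w) = w"
  by (auto simp: steps_def walk_path_def fun_eq_iff prod_eq_iff)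

lemma walk_cong: "(\<And>k. k < n \<Longrightarrow> w k = w' k) \<Longrightarrow> walk w n = walk w' n"
  by (induction n) auto

lemma walk_steps:
  assumes "x \<in> pascal_paths"
  shows "walk (steps x) n = fst (x n)"
proof (induction n)
  case 0
  then show ?case using assms by (simp add: pascal_paths_def)
next
  case (Suc n)
  have "x n \<in> pascal_edges" "snd (x n) = fst (x (Suc n))"
    using assms by (auto simp: pascal_paths_def)
  then show ?case using Suc by (auto simp: pascal_edges_def steps_def)
qed

lemma walk_path_steps:
  assumes "x \<in> pascal_paths"
  shows "walk_path (steps x) = x"
proof
  fix n
  have "snd (x n) = fst (x (Suc n))" using assms by (auto simp: pascal_paths_def)
  then show "walk_path (steps x) n = x n"
    unfolding walk_path_def using walk_steps[OF assms] by (simp add: prod_eq_iff del: walk.simps)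
qed

lemma walk_path_in_cylinder_iff:
  assumes "x \<in> pascal_paths"
  shows "walk_path w \<in> cylinder x n \<longleftrightarrow> (\<forall>k<n. w k = steps x k)"
proof
  assume "walk_path w \<in> cylinder x n"
  then have "\<forall>k<n. walk_path w k = x k" by (simp add: cylinder_def)
  then have "\<forall>k<n. steps (walk_path w) k = steps x k" unfolding steps_def by simp
  then show "\<forall>k<n. w k = steps x k" by simp
next
  assume *: "\<forall>k<n. w k = steps x k"
  have "walk_path w k = walk_path (steps x) k" if "k < n" for k
    unfolding walk_path_def using * that
    by (auto simp del: walk.simps intro!: walk_cong)
  then show "walk_path w \<in> cylinder x n"
    using walk_path_in_paths by (simp add: cylinder_def walk_path_steps[OF assms])
qed

lemma cylinder_0: "cylinder x 0 = pascal_paths"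
  by (auto simp: cylinder_def)

lemma paths_in_cylinders: "pascal_paths \<in> cylinders"
  using walk_path_in_paths cylinder_0 unfolding cylinders_def by blast

lemma Union_cylinders: "\<Union>cylinders = pascal_paths"
  using paths_in_cylinders by (auto simp: cylinders_def cylinder_def)

lemma topspace_path_topology [simp]: "topspace path_topology = pascal_paths"
  by (simp add: path_topology_def Union_cylinders)

lemma cylinder_Int:
  assumes "A \<in> cylinders" "B \<in> cylinders"
  shows "A \<inter> B = {} \<or> A \<inter> B \<in> cylinders"
proof (cases "A \<inter> B = {}")
  case False
  obtain x n y m where AB: "A = cylinder x n" "B = cylinder y m"
    using assms by (auto simp: cylinders_def)
  obtain z where z: "z \<in> A" "z \<in> B" using False by auto
  have "A = cylinder z n" "B = cylinder z m" "z \<in> pascal_paths"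
    using z unfolding AB by (auto simp: cylinder_def)
  moreover have "cylinder z n \<inter> cylinder z m = cylinder z (max n m)"
    by (auto simp: cylinder_def less_max_iff_disj)
  ultimately show ?thesis unfolding cylinders_def by blast
qed simp

lemma countable_cylinders: "countable cylinders"
proof -
  have "cylinders \<subseteq> range (\<lambda>es. {y \<in> pascal_paths. \<forall>k<length es. y k = es ! k})"
  proof
    fix A assume "A \<in> cylinders"
    then obtain x n where A: "A = cylinder x n" by (auto simp: cylinders_def)
    have "A = {y \<in> pascal_paths. \<forall>k<length (map x [0..<n]). y k = map x [0..<n] ! k}"
      unfolding A by (auto simp: cylinder_def)
    then show "A \<in> range (\<lambda>es. {y \<in> pascal_paths. \<forall>k<length es. y k = es ! k})" by blast
  qed
  then show ?thesis by (rule countable_subset) auto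
qed

lemma open_is_Union_of_cylinders:
  assumes "openin path_topology U"
  shows "\<exists>K\<subseteq>cylinders. U = \<Union>K"
proof -
  have "generate_topology_on cylinders U"
    using assms unfolding path_topology_def by (rule openin_topology_generated_by)
  then show ?thesis
  proof induction
    case Empty
    show ?case by (rule exI[of _ "{}"]) simp
  next
    case (Int a b)
    then obtain K L where *: "K \<subseteq> cylinders" "a = \<Union>K" "L \<subseteq> cylinders" "b = \<Union>L" by blast
    have "a \<inter> b = \<Union>{A \<inter> B | A B. A \<in> K \<and> B \<in> L \<and> A \<inter> B \<noteq> {}}"
      unfolding * by blast
    moreover have "{A \<inter> B | A B. A \<in> K \<and> B \<in> L \<and> A \<inter> B \<noteq> {}} \<subseteq> cylinders"
      using * cylinder_Int by blast
    ultimately show ?case by blast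
  next
    case (UN K)
    then have "\<forall>k\<in>K. \<exists>L\<subseteq>cylinders. k = \<Union>L" by blast
    then obtain f where f: "\<And>k. k \<in> K \<Longrightarrow> f k \<subseteq> cylinders \<and> k = \<Union>(f k)" by metis
    have "\<Union>K = \<Union>(\<Union>k\<in>K. f k)" using f by blast
    moreover have "(\<Union>k\<in>K. f k) \<subseteq> cylinders" using f by blast
    ultimately show ?case by blast
  next
    case (Basis s)
    then show ?case by (intro exI[of _ "{s}"]) simp
  qed
qed

lemma space_path_borel [simp]: "space path_borel = pascal_paths"
  by (simp add: path_borel_def space_measure_of_conv)

lemma cylinders_subset_Pow: "cylinders \<subseteq> Pow pascal_paths"
  by (auto simp: cylinders_def cylinder_def)

lemma sets_path_borel: "sets path_borel = sigma_sets pascal_paths cylinders"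
proof -
  have sub: "{U. openin path_topology U} \<subseteq> Pow pascal_paths"
    using openin_subset[of path_topology] by auto
  have "sets path_borel = sigma_sets pascal_paths {U. openin path_topology U}"
    using sub by (simp add: path_borel_def)
  also have "\<dots> = sigma_sets pascal_paths cylinders"
  proof (rule sigma_sets_eqI)
    fix U assume "U \<in> {U. openin path_topology U}"
    then obtain K where K: "K \<subseteq> cylinders" "U = \<Union>K"
      using open_is_Union_of_cylinders by auto
    interpret sigma_algebra pascal_paths "sigma_sets pascal_paths cylinders"
      using cylinders_subset_Pow by (rule sigma_algebra_sigma_sets)
    have "countable K" using K countable_cylinders countable_subset by blast
    then show "U \<in> sigma_sets pascal_paths cylinders"
      unfolding K(2) by (rule countable_Union) (use K(1) in auto)
  next
    fix A assume "A \<in> cylinders"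
    then show "A \<in> sigma_sets pascal_paths {U. openin path_topology U}"
      by (auto simp: path_topology_def intro!: topology_generated_by_Basis)
  qed
  finally show ?thesis .
qed

lemma is_pascal_measure_unique:
  assumes "is_pascal_measure p M" "is_pascal_measure p N"
  shows "M = N"
proof (rule measure_eqI_generator_eq_countable)
  interpret M: prob_space M using assms by (simp add: is_pascal_measure_def)
  interpret N: prob_space N using assms by (simp add: is_pascal_measure_def)
  show "Int_stable (insert {} cylinders)"
    using cylinder_Int by (auto simp: Int_stable_def)
  show "insert {} cylinders \<subseteq> Pow pascal_paths" using cylinders_subset_Pow by auto
  show "emeasure M X = emeasure N X" if "X \<in> insert {} cylinders" for X
    using that assms
    by (auto simp: is_pascal_measure_def cylinders_def M.emeasure_eq_measure N.emeasure_eq_measure)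
  have "sigma_sets pascal_paths (insert {} cylinders) = sigma_sets pascal_paths cylinders"
    by (rule sigma_sets_eqI) (auto intro: sigma_sets.Empty)
  then show "sets M = sigma_sets pascal_paths (insert {} cylinders)"
    "sets N = sigma_sets pascal_paths (insert {} cylinders)"
    using assms by (auto simp: is_pascal_measure_def sets_path_borel)
  show "{pascal_paths} \<subseteq> insert {} cylinders" using paths_in_cylinders by auto
  show "emeasure M a \<noteq> \<infinity>" for a by simp
qed auto

lemma is_pascal_measure_exists:
  assumes "0 < p" "p < 1"
  shows "\<exists>M. is_pascal_measure p M"
proof -
  let ?B = "\<lambda>_::nat. measure_pmf (bernoulli_pmf p)"
  interpret product_prob_space ?B UNIV by unfold_locales
  let ?P = "PiM UNIV ?B"
  have space_P: "space ?P = UNIV" by (simp add: space_PiM)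
  have vimage: "walk_path -` cylinder x n \<inter> space ?P
      = {w \<in> space ?P. \<forall>k\<in>{..<n}. w k \<in> {steps x k}}" if "x \<in> pascal_paths" for x n
    using walk_path_in_cylinder_iff[OF that] by auto
  have meas: "walk_path \<in> measurable ?P path_borel"
  proof (rule measurable_sigma_sets[OF sets_path_borel cylinders_subset_Pow])
    show "walk_path \<in> space ?P \<rightarrow> pascal_paths" using walk_path_in_paths by auto
    fix A assume "A \<in> cylinders"
    then obtain x n where A: "A = cylinder x n" and x: "x \<in> pascal_paths"
      by (auto simp: cylinders_def)
    show "walk_path -` A \<inter> space ?P \<in> sets ?P"
      unfolding A vimage[OF x]
      by (intro sets.sets_Collect_finite_All sets_Collect_single') auto
  qed
  let ?M = "distr ?P path_borel walk_path"
  have "is_pascal_measure p ?M"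
    unfolding is_pascal_measure_def
  proof (intro conjI ballI allI)
    show "prob_space ?M" using meas by (rule P.prob_space_distr)
    fix x n assume x: "x \<in> pascal_paths"
    have "cylinder x n \<in> sets path_borel"
      unfolding sets_path_borel using x by (auto simp: cylinders_def)
    then have "emeasure ?M (cylinder x n) = emeasure ?P (walk_path -` cylinder x n \<inter> space ?P)"
      using meas by (intro emeasure_distr)
    also have "\<dots> = (\<Prod>k<n. emeasure (bernoulli_pmf p) {steps x k})"
      unfolding vimage[OF x] by (intro emeasure_PiM_Collect) auto
    also have "\<dots> = (\<Prod>k<n. ennreal (edge_weight p (x k)))"
      using assms
      by (intro prod.cong) (auto simp: emeasure_pmf_single edge_weight_def steps_def)
    also have "\<dots> = ennreal (\<Prod>k<n. edge_weight p (x k))"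
      using assms by (intro prod_ennreal) (auto simp: edge_weight_def)
    finally show "measure ?M (cylinder x n) = (\<Prod>k<n. edge_weight p (x k))"
      using assms by (auto simp: measure_def edge_weight_def intro!: enn2real_ennreal prod_nonneg)
  qed simp
  then show ?thesis by blast
qed

theorem ex1_is_pascal_measure:
  "0 < p \<Longrightarrow> p < 1 \<Longrightarrow> \<exists>!M. is_pascal_measure p M"
  using is_pascal_measure_exists is_pascal_measure_unique by blast

corollary is_pascal_measure_pascal_measure:
  "0 < p \<Longrightarrow> p < 1 \<Longrightarrow> is_pascal_measure p (pascal_measure p)"
  unfolding pascal_measure_def by (rule theI') (rule ex1_is_pascal_measure)

lemma subdiagram_paths_in_sets: "subdiagram_paths W \<in> sets path_borel"
proof -
  have *: "{x \<in> pascal_paths. x n = e} \<in> sets path_borel" for n e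
  proof -
    have "openin path_topology (\<Union>{C \<in> cylinders. C \<subseteq> {x \<in> pascal_paths. x n = e}})"
      by (intro openin_Union) (auto simp: path_topology_def intro: topology_generated_by_Basis)
    moreover have "\<Union>{C \<in> cylinders. C \<subseteq> {x \<in> pascal_paths. x n = e}} = {x \<in> pascal_paths. x n = e}"
    proof (intro equalityI subsetI)
      fix x assume x: "x \<in> {x \<in> pascal_paths. x n = e}"
      then have "cylinder x (Suc n) \<in> cylinders" "x \<in> cylinder x (Suc n)"
        "cylinder x (Suc n) \<subseteq> {x \<in> pascal_paths. x n = e}"
        by (auto simp: cylinders_def cylinder_def)
      then show "x \<in> \<Union>{C \<in> cylinders. C \<subseteq> {x \<in> pascal_paths. x n = e}}" by blast
    qed auto
    moreover have "{U. openin path_topology U} \<subseteq> Pow (topspace path_topology)"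
      using openin_subset[of path_topology] by blast
    ultimately show ?thesis by (auto simp: path_borel_def)
  qed
  have "{x \<in> space path_borel. \<forall>n. x n \<in> subdiagram_edges W} \<in> sets path_borel"
  proof (rule sets.sets_Collect_countable_All)
    fix n
    have "{x \<in> space path_borel. x n \<in> subdiagram_edges W}
        = (\<Union>e\<in>subdiagram_edges W. {x \<in> pascal_paths. x n = e})" by auto
    also have "\<dots> \<in> sets path_borel" using * by (intro sets.countable_UN') auto
    finally show "{x \<in> space path_borel. x n \<in> subdiagram_edges W} \<in> sets path_borel" .
  qed
  then show ?thesis by (simp add: subdiagram_paths_def)
qed

end

theory Submission
  imports Defs "HOL-Real_Asymp.Real_Asymp"
begin

text \<open>
  The idea is to separate the parameters by the law of large numbers. Along a
  \<open>\<nu>\<^sub>p\<close>-random path the proportion of steps in the first direction tends to \<open>p\<close>. Fix a bound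
  \<open>\<delta> n\<close> with \<open>\<delta> n \<rightarrow> 0\<close> and keep at each level \<open>n \<ge> N\<close> only the vertices \<open>(i, j)\<close> with
  \<open>\<bar>i / n - p\<bar> < \<delta> n\<close>. The proportion then tends to \<open>p\<close> along every path that stays inside this
  window, without exception, so a path cannot stay inside the windows of two different parameters.
  This is the disjointness.

  The window must still catch almost all of the mass. Under \<open>\<nu>\<^sub>p\<close> the first coordinate at level
  \<open>n\<close> has the binomial distribution (\<open>measure_level_binomial\<close>), so Hoeffding's inequality bounds the
  probability of leaving the window at level \<open>n\<close> by \<open>2 exp (- 2 n (\<delta> n)\<^sup>2)\<close>. The choice
  \<open>\<delta> n = sqrt (ln n / n)\<close> tends to zero and makes this bound equal to \<open>2 / n\<^sup>2\<close>. These bounds are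
  summable and do not involve \<open>p\<close>, so a union bound beyond a large \<open>N\<close> gives
  \<open>measure_window_paths\<close>.

  A window need not be a vertex subdiagram itself, since it may contain vertices at which paths
  inside it get stuck, or which they cannot reach. Keeping only the vertices that are visited by
  an infinite path inside the window repairs this and leaves the set of such paths unchanged.
\<close>

section \<open>Subdiagrams from families of allowed vertices\<close>

definition confined_paths :: "(nat \<Rightarrow> vertex set) \<Rightarrow> (nat \<Rightarrow> edge) set" where
  "confined_paths A = {x \<in> pascal_paths. \<forall>n. fst (x n) \<in> A n}"

definition visited_vertices :: "(nat \<Rightarrow> edge) set \<Rightarrow> nat \<Rightarrow> vertex set" where
  "visited_vertices X n = (\<lambda>x. fst (x n)) ` X"

lemma confined_path_edge_in_subdiagram:
  assumes "x \<in> confined_paths A"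
  shows "x n \<in> subdiagram_edges (visited_vertices (confined_paths A))"
proof -
  have "x n \<in> pascal_edges" "snd (x n) = fst (x (Suc n))"
    using assms by (auto simp: confined_paths_def pascal_paths_def)
  then show ?thesis
    using assms unfolding subdiagram_edges_def visited_vertices_def by auto
qed

text \<open>The edges of a path inside the given sets witness both that every visited vertex has a
  successor and that every visited vertex below the root has a predecessor.\<close>

lemma vertex_subdiagram_visited_vertices:
  assumes "confined_paths A \<noteq> {}"
  shows "vertex_subdiagram (visited_vertices (confined_paths A))" (is "vertex_subdiagram ?W")
  unfolding vertex_subdiagram_def
proof (intro allI conjI ballI)
  fix n
  show "?W n \<noteq> {}" using assms by (simp add: visited_vertices_def)
  show "?W n \<subseteq> pascal_level n"
    by (auto simp: visited_vertices_def confined_paths_def pascal_paths_def)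
  show "\<exists>e\<in>subdiagram_edges ?W. fst e = v" if "v \<in> ?W n" for v
    using that confined_path_edge_in_subdiagram[of _ A n] by (auto simp: visited_vertices_def)
  show "\<exists>e\<in>subdiagram_edges ?W. snd e = v" if v: "v \<in> ?W (Suc n)" for v
  proof -
    obtain x where x: "x \<in> confined_paths A" "v = fst (x (Suc n))"
      using v by (auto simp: visited_vertices_def)
    then have "snd (x n) = v" by (simp add: confined_paths_def pascal_paths_def)
    then show ?thesis using confined_path_edge_in_subdiagram[OF x(1), of n] by blast
  qed
qed

text \<open>Concatenating edges of different confined paths produces no path that leaves the given
  sets, because being confined is a condition on single vertices and each vertex determines its
  level.\<close>

lemma subdiagram_paths_visited_vertices:
  "subdiagram_paths (visited_vertices (confined_paths A)) = confined_paths A"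
proof (intro equalityI subsetI)
  fix x assume "x \<in> subdiagram_paths (visited_vertices (confined_paths A))"
  then have x: "x \<in> pascal_paths"
    and edge: "\<And>n. x n \<in> subdiagram_edges (visited_vertices (confined_paths A))"
    by (auto simp: subdiagram_paths_def)
  have "fst (x n) \<in> A n" for n
  proof -
    obtain m y where y: "y \<in> confined_paths A" "fst (x n) = fst (y m)"
      using edge[of n] by (auto simp: subdiagram_edges_def visited_vertices_def)
    have "fst (x n) \<in> pascal_level n" "fst (y m) \<in> pascal_level m"
      using x y(1) by (auto simp: confined_paths_def pascal_paths_def)
    then have "m = n" using y(2) by (auto simp: pascal_level_def)
    then show ?thesis using y by (auto simp: confined_paths_def)
  qed
  then show "x \<in> confined_paths A" using x by (simp add: confined_paths_def)
next
  fix x assume x: "x \<in> confined_paths A"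
  then show "x \<in> subdiagram_paths (visited_vertices (confined_paths A))"
    using confined_path_edge_in_subdiagram[OF x]
    by (simp add: subdiagram_paths_def confined_paths_def)
qed

section \<open>The distribution at a level\<close>

lemma fst_walk: "fst (walk w n) = card {k\<in>{..<n}. w k}"
proof (induction n)
  case (Suc n)
  have "{k\<in>{..<Suc n}. w k} = (if w n then insert n {k\<in>{..<n}. w k} else {k\<in>{..<n}. w k})"
    by (auto simp: less_Suc_eq)
  then show ?case using Suc by simp
qed simp

lemma cylinder_in_sets: "x \<in> pascal_paths \<Longrightarrow> cylinder x n \<in> sets path_borel"
  by (auto simp: sets_path_borel cylinders_def)

lemma prod_edge_weight_walk_path:
  assumes "S \<subseteq> {..<n}"
  shows "(\<Prod>k<n. edge_weight p (walk_path (\<lambda>k. k \<in> S) k)) = p ^ card S * (1 - p) ^ (n - card S)"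
proof -
  have fin: "finite S" using assms finite_subset by blast
  have "(\<Prod>k<n. edge_weight p (walk_path (\<lambda>k. k \<in> S) k)) = (\<Prod>k<n. if k \<in> S then p else 1 - p)"
    by (intro prod.cong) (auto simp: edge_weight_def walk_path_def prod_eq_iff)
  also have "\<dots> = p ^ card ({..<n} \<inter> S) * (1 - p) ^ card ({..<n} - S)"
    by (simp add: prod.If_cases Diff_eq)
  also have "\<dots> = p ^ card S * (1 - p) ^ (n - card S)"
    using assms fin by (simp add: Int_absorb1 card_Diff_subset)
  finally show ?thesis .
qed

text \<open>A set \<open>S\<close> of times below \<open>n\<close> names the cylinder of the paths that step in the first
  direction exactly at the times in \<open>S\<close>.\<close>

lemma level_event_eq_Union_cylinders:
  "{x \<in> pascal_paths. fst (fst (x n)) = i}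
    = (\<Union>S\<in>{S. S \<subseteq> {..<n} \<and> card S = i}. cylinder (walk_path (\<lambda>k. k \<in> S)) n)"
    (is "?L = ?R")
proof (intro equalityI subsetI)
  fix x assume x: "x \<in> ?L"
  let ?S = "{k\<in>{..<n}. steps x k}"
  have "card ?S = i" using x fst_walk[of "steps x" n] by (simp add: walk_steps)
  moreover have "x \<in> cylinder (walk_path (\<lambda>k. k \<in> ?S)) n"
    using walk_path_in_cylinder_iff[OF walk_path_in_paths, of "steps x" "\<lambda>k. k \<in> ?S" n] x
    by (simp add: walk_path_steps)
  moreover have "?S \<subseteq> {..<n}" by auto
  ultimately show "x \<in> ?R" by (intro UN_I[of ?S] CollectI conjI)
next
  fix x assume "x \<in> ?R"
  then obtain S where S: "S \<subseteq> {..<n}" "card S = i"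
    and x: "x \<in> cylinder (walk_path (\<lambda>k. k \<in> S)) n" by (elim UN_E CollectE conjE)
  have path: "x \<in> pascal_paths" using x by (simp add: cylinder_def)
  have "steps x k \<longleftrightarrow> k \<in> S" if "k < n" for k
    using walk_path_in_cylinder_iff[OF walk_path_in_paths, of "steps x" "\<lambda>k. k \<in> S" n] x that
    by (simp add: walk_path_steps path)
  then have "{k\<in>{..<n}. steps x k} = S" using S(1) by auto
  then have "fst (walk (steps x) n) = i" using S(2) by (simp add: fst_walk)
  then show "x \<in> ?L" using path by (simp add: walk_steps)
qed

lemma disjoint_step_cylinders:
  "disjoint_family_on (\<lambda>S. cylinder (walk_path (\<lambda>k. k \<in> S)) n) {S. S \<subseteq> {..<n} \<and> card S = i}"
  unfolding disjoint_family_on_def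
proof (intro ballI impI, rule ccontr)
  fix S T
  assume S: "S \<in> {S. S \<subseteq> {..<n} \<and> card S = i}" and T: "T \<in> {S. S \<subseteq> {..<n} \<and> card S = i}"
    and "S \<noteq> T" and "cylinder (walk_path (\<lambda>k. k \<in> S)) n \<inter> cylinder (walk_path (\<lambda>k. k \<in> T)) n \<noteq> {}"
  then obtain x where x: "x \<in> cylinder (walk_path (\<lambda>k. k \<in> S)) n"
      "x \<in> cylinder (walk_path (\<lambda>k. k \<in> T)) n"
    by blast
  have "k \<in> S \<longleftrightarrow> k \<in> T" if "k < n" for k
  proof -
    have "walk_path (\<lambda>k. k \<in> S) k = walk_path (\<lambda>k. k \<in> T) k"
      using x that by (simp add: cylinder_def)
    then have "steps (walk_path (\<lambda>k. k \<in> S)) k = steps (walk_path (\<lambda>k. k \<in> T)) k"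
      by (simp only: steps_def)
    then show ?thesis by simp
  qed
  then have "S = T" using S T by blast
  then show False using \<open>S \<noteq> T\<close> by simp
qed

lemma level_event_in_sets: "{x \<in> pascal_paths. fst (fst (x n)) \<in> K} \<in> sets path_borel"
proof -
  have "{x \<in> pascal_paths. fst (fst (x n)) = i} \<in> sets path_borel" for i
    unfolding level_event_eq_Union_cylinders
    by (intro sets.finite_UN cylinder_in_sets walk_path_in_paths) auto
  then have "(\<Union>i\<in>K. {x \<in> pascal_paths. fst (fst (x n)) = i}) \<in> sets path_borel"
    by (intro sets.countable_UN') auto
  moreover have "(\<Union>i\<in>K. {x \<in> pascal_paths. fst (fst (x n)) = i})
      = {x \<in> pascal_paths. fst (fst (x n)) \<in> K}" by auto
  ultimately show ?thesis by simp
qed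

context
  fixes p :: real
  assumes p: "0 < p" "p < 1"
begin

lemma prob_space_pascal_measure: "prob_space (pascal_measure p)"
  using is_pascal_measure_pascal_measure[OF p] by (simp add: is_pascal_measure_def)

lemma sets_pascal_measure [simp]: "sets (pascal_measure p) = sets path_borel"
  using is_pascal_measure_pascal_measure[OF p] by (simp add: is_pascal_measure_def)

lemma space_pascal_measure [simp]: "space (pascal_measure p) = pascal_paths"
  using sets_eq_imp_space_eq[OF sets_pascal_measure] by simp

lemma measure_vertex:
  "measure (pascal_measure p) {x \<in> pascal_paths. fst (fst (x n)) = i} = pmf (binomial_pmf n p) i"
proof -
  interpret prob_space "pascal_measure p" by (rule prob_space_pascal_measure)
  have "prob {x \<in> pascal_paths. fst (fst (x n)) = i}
      = (\<Sum>S\<in>{S. S \<subseteq> {..<n} \<and> card S = i}. prob (cylinder (walk_path (\<lambda>k. k \<in> S)) n))"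
    unfolding level_event_eq_Union_cylinders
    by (intro finite_measure_finite_Union disjoint_step_cylinders)
       (auto intro: cylinder_in_sets walk_path_in_paths)
  also have "\<dots> = (\<Sum>S\<in>{S. S \<subseteq> {..<n} \<and> card S = i}. p ^ i * (1 - p) ^ (n - i))"
    using is_pascal_measure_pascal_measure[OF p] walk_path_in_paths
    by (intro sum.cong) (auto simp: is_pascal_measure_def prod_edge_weight_walk_path)
  also have "\<dots> = pmf (binomial_pmf n p) i"
    using p by (simp add: n_subsets)
  finally show ?thesis .
qed

lemma measure_level_binomial:
  "measure (pascal_measure p) {x \<in> pascal_paths. fst (fst (x n)) \<in> K}
    = measure_pmf.prob (binomial_pmf n p) K"
proof -
  interpret prob_space "pascal_measure p" by (rule prob_space_pascal_measure)
  have le: "fst (fst (x n)) \<le> n" if "x \<in> pascal_paths" for x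
  proof -
    have "fst (x n) \<in> pascal_level n" using that by (simp add: pascal_paths_def)
    then show ?thesis by (auto simp: pascal_level_def)
  qed
  have "{x \<in> pascal_paths. fst (fst (x n)) \<in> K}
      = (\<Union>i\<in>K \<inter> {..n}. {x \<in> pascal_paths. fst (fst (x n)) = i})"
    using le by auto
  also have "prob \<dots> = (\<Sum>i\<in>K \<inter> {..n}. prob {x \<in> pascal_paths. fst (fst (x n)) = i})"
    using level_event_in_sets[of n "{_}"]
    by (intro finite_measure_finite_Union) (auto simp: disjoint_family_on_def)
  also have "\<dots> = measure_pmf.prob (binomial_pmf n p) (K \<inter> {..n})"
    by (simp add: measure_vertex measure_measure_pmf_finite)
  also have "\<dots> = measure_pmf.prob (binomial_pmf n p) K"
    using p measure_Int_set_pmf[of "binomial_pmf n p" K] by simp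
  finally show ?thesis .
qed

end

section \<open>Windows around the mean\<close>

definition off_mean :: "real \<Rightarrow> nat \<Rightarrow> nat set" where
  "off_mean p n = {i. \<bar>real i / real n - p\<bar> \<ge> sqrt (ln (real n) / real n)}"

definition window :: "nat \<Rightarrow> real \<Rightarrow> nat \<Rightarrow> vertex set" where
  "window N p n = {v. n \<ge> N \<longrightarrow> fst v \<notin> off_mean p n}"

text \<open>The width \<open>sqrt (ln n / n)\<close> turns the exponential of the Hoeffding bound into a power
  of \<open>n\<close>.\<close>

lemma measure_off_mean:
  assumes p: "0 < p" "p < 1" and n: "0 < n"
  shows "measure (pascal_measure p) {x \<in> pascal_paths. fst (fst (x n)) \<in> off_mean p n}
         \<le> 2 * inverse (real n ^ 2)" (is "?lhs \<le> _")
proof -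
  let ?\<delta> = "sqrt (ln (real n) / real n)"
  have binomial: "binomial_distribution p" by unfold_locales (use p in auto)
  have "?lhs = measure_pmf.prob (binomial_pmf n p) {i. \<bar>real i / real n - p\<bar> \<ge> ?\<delta>}"
    unfolding off_mean_def by (rule measure_level_binomial[OF p])
  also have "\<dots> \<le> 2 * exp (- 2 * real n * ?\<delta>\<^sup>2)"
    using n binomial_distribution.prob_abs_ge'[OF binomial n, of ?\<delta>] by simp
  also have "- 2 * real n * ?\<delta>\<^sup>2 = - (2 * ln (real n))"
    using n by simp
  also have "exp (- (2 * ln (real n))) = inverse (real n ^ 2)"
    using n by (simp add: exp_minus exp_double)
  finally show ?thesis .
qed

text \<open>The level \<open>N\<close> is any one beyond which the exit bounds sum to less than \<open>\<epsilon>\<close>; it serves all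
  parameters at once.\<close>

lemma measure_window_paths:
  assumes "\<epsilon> > 0"
  obtains N where
    "\<And>p. 0 < p \<Longrightarrow> p < 1 \<Longrightarrow> measure (pascal_measure p) (confined_paths (window N p)) > 1 - \<epsilon>"
proof -
  have summable: "summable (\<lambda>n. 2 * inverse (real n ^ 2))"
    by (intro summable_mult inverse_power_summable) simp
  obtain N0 where N0: "\<And>n. n \<ge> N0 \<Longrightarrow> norm (\<Sum>k. 2 * inverse (real (k + n) ^ 2)) < \<epsilon>"
    using suminf_exist_split[OF assms summable] by auto
  \<comment> \<open>Level zero is excluded: division by the level is meaningless there.\<close>
  define N where "N = Suc N0"
  have tail: "(\<Sum>k. 2 * inverse (real (k + N) ^ 2)) < \<epsilon>"
    using N0[of N] by (simp add: N_def)
  have "measure (pascal_measure p) (confined_paths (window N p)) > 1 - \<epsilon>"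
    if p: "0 < p" "p < 1" for p
  proof -
    interpret prob_space "pascal_measure p" by (rule prob_space_pascal_measure[OF p])
    define exits where
      "exits k = {x \<in> pascal_paths. fst (fst (x (k + N))) \<in> off_mean p (k + N)}" for k
    have exits_sets: "exits k \<in> events" for k
      unfolding exits_def sets_pascal_measure[OF p] by (rule level_event_in_sets)
    have exits_le: "prob (exits k) \<le> 2 * inverse (real (k + N) ^ 2)" for k
      unfolding exits_def by (rule measure_off_mean[OF p]) (simp add: N_def)
    have summable_tail: "summable (\<lambda>k. 2 * inverse (real (k + N) ^ 2))"
      using summable by (rule summable_ignore_initial_segment)
    have summable_exits: "summable (\<lambda>k. prob (exits k))"
      by (rule summable_comparison_test'[OF summable_tail, of 0]) (use exits_le in auto)
    have "prob (\<Union>k. exits k) \<le> (\<Sum>k. prob (exits k))"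
      using exits_sets summable_exits by (intro finite_measure_subadditive_countably) auto
    also have "\<dots> \<le> (\<Sum>k. 2 * inverse (real (k + N) ^ 2))"
      by (intro suminf_le exits_le summable_exits summable_tail)
    finally have small: "prob (\<Union>k. exits k) < \<epsilon>" using tail by simp
    have "confined_paths (window N p) = space (pascal_measure p) - (\<Union>k. exits k)"
    proof (intro equalityI subsetI)
      fix x assume "x \<in> confined_paths (window N p)"
      then show "x \<in> space (pascal_measure p) - (\<Union>k. exits k)"
        by (simp add: space_pascal_measure[OF p] confined_paths_def window_def exits_def)
    next
      fix x assume "x \<in> space (pascal_measure p) - (\<Union>k. exits k)"
      then have x: "x \<in> pascal_paths" "\<And>k. x \<notin> exits k"
        by (simp_all add: space_pascal_measure[OF p])
      have "fst (x n) \<in> window N p n" for n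
        using x(1) x(2)[of "n - N"] by (auto simp: exits_def window_def)
      then show "x \<in> confined_paths (window N p)" using x(1) by (simp add: confined_paths_def)
    qed
    then have "prob (confined_paths (window N p)) = 1 - prob (\<Union>k. exits k)"
      using exits_sets by (simp add: prob_compl sets.countable_UN)
    then show ?thesis using small by simp
  qed
  then show ?thesis using that by blast
qed

lemma window_path_proportion_tendsto:
  assumes "x \<in> confined_paths (window N p)"
  shows "(\<lambda>n. real (fst (fst (x n))) / real n) \<longlonglongrightarrow> p"
proof -
  have "(\<lambda>n. real (fst (fst (x n))) / real n - p) \<longlonglongrightarrow> 0"
  proof (rule Lim_null_comparison)
    show "\<forall>\<^sub>F n in sequentially.
        norm (real (fst (fst (x n))) / real n - p) \<le> sqrt (ln (real n) / real n)"
      using eventually_ge_at_top[of N]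
    proof eventually_elim
      case (elim n)
      have "fst (x n) \<in> window N p n" using assms by (simp add: confined_paths_def)
      then have "fst (fst (x n)) \<notin> off_mean p n" using elim by (simp add: window_def)
      then show ?case
        unfolding off_mean_def by (simp only: mem_Collect_eq not_le real_norm_def less_imp_le)
    qed
    show "(\<lambda>n. sqrt (ln (real n) / real n)) \<longlonglongrightarrow> 0" by real_asymp
  qed
  then show ?thesis by (simp add: LIM_zero_iff)
qed

theorem theorem3p1:
  fixes \<epsilon> :: real
  assumes "\<epsilon> > 0"
  shows "\<exists>B :: real \<Rightarrow> nat \<Rightarrow> vertex set.
           (\<forall>p\<in>{0<..<1}. vertex_subdiagram (B p)) \<and>
           (\<forall>p\<in>{0<..<1}. measure (pascal_measure p) (subdiagram_paths (B p)) > 1 - \<epsilon>) \<and>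
           disjoint_family_on (\<lambda>p. subdiagram_paths (B p)) {0<..<1}"
proof -
  \<comment> \<open>The levels of a vertex subdiagram are nonempty, so its path space must have positive measure
    even when \<open>\<epsilon>\<close> exceeds one.\<close>
  have "min \<epsilon> 1 > 0" using assms by simp
  then obtain N where N: "\<And>p. 0 < p \<Longrightarrow> p < 1 \<Longrightarrow>
      measure (pascal_measure p) (confined_paths (window N p)) > 1 - min \<epsilon> 1"
    by (rule measure_window_paths) blast
  let ?B = "\<lambda>p. visited_vertices (confined_paths (window N p))"
  have "vertex_subdiagram (?B p)" if "p \<in> {0<..<1}" for p
  proof (rule vertex_subdiagram_visited_vertices)
    have "measure (pascal_measure p) (confined_paths (window N p)) > 0"
      using N[of p] that by simp
    then show "confined_paths (window N p) \<noteq> {}" by auto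
  qed
  moreover have "measure (pascal_measure p) (subdiagram_paths (?B p)) > 1 - \<epsilon>"
    if "p \<in> {0<..<1}" for p
    using N[of p] that by (simp add: subdiagram_paths_visited_vertices)
  moreover have "disjoint_family_on (\<lambda>p. subdiagram_paths (?B p)) {0<..<1}"
    unfolding disjoint_family_on_def subdiagram_paths_visited_vertices
    using window_path_proportion_tendsto LIMSEQ_unique by blast
  ultimately show ?thesis by (intro exI[of _ ?B]) blast
qed

end
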